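(* Let $R$ be a commutative ring, $M$ an $R$-module and $Y\subseteq q\mathrm{Spec}(M)$. Let $\Im(Y)$ be the intersection of all elements of $Y$. Then $\Im(Y)$ is a quasi-prime submodule of $M$ if and only if $Y$ is an irreducible space (with the subspace topology induced from the developed Zariski topology on $q\mathrm{Spec}(M)$).
   Context: All rings are commutative with nonzero identity and all modules are unital. For a submodule $N$ of $M$, $(N:M)=\{r\in R\mid rM\subseteq N\}$. A proper ideal $I$ of a ring is quasi-prime if for all ideals $A,B$, $A\cap B\subseteq I$ implies $A\subseteq I$ or $B\subseteq I$. A proper submodule $N$ of $M$ is quasi-prime if $(N:M)$ is a quasi-prime ideal. $q\mathrm{Spec}(M)$ is the set of quasi-prime submodules of $M$. For a submodule $N$ of $M$, $D(N)=\{L\in q\mathrm{Spec}(M)\mid (L:M)\supseteq (N:M)\}$. The developed Zariski topology on $q\mathrm{Spec}(M)$ is the topology whose closed sets are exactly the sets $D(N)$, $N$ a submodule of $M$. The intersection of the empty family of submodules is $M$. A topological space $X$ is irreducible if $X\neq\emptyset$ and every two non-empty open subsets of $X$ intersect. *)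

theory Defs
  imports "HOL-Algebra.Module" "HOL-Algebra.Ideal" "HOL-Analysis.Abstract_Topology"
begin

text \<open>Imported theories outside HOL-Algebra also provide a type-class based locale
  called module; the qualified name \<open>Module.module\<close> is the carrier-based one of HOL-Algebra.\<close>

definition colon :: "('a, 'r) ring_scheme \<Rightarrow> ('a, 'b, 'm) module_scheme \<Rightarrow> 'b set \<Rightarrow> 'a set" where
  "colon R M N = {r \<in> carrier R. \<forall>m\<in>carrier M. r \<odot>\<^bsub>M\<^esub> m \<in> N}"

definition quasi_prime_ideal :: "('a, 'r) ring_scheme \<Rightarrow> 'a set \<Rightarrow> bool" where
  "quasi_prime_ideal R I \<longleftrightarrow>
     ideal I R \<and> I \<noteq> carrier R \<and>
     (\<forall>A B. ideal A R \<longrightarrow> ideal B R \<longrightarrow> A \<inter> B \<subseteq> I \<longrightarrow> A \<subseteq> I \<or> B \<subseteq> I)"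

definition quasi_prime_submodule ::
  "('a, 'r) ring_scheme \<Rightarrow> ('a, 'b, 'm) module_scheme \<Rightarrow> 'b set \<Rightarrow> bool" where
  "quasi_prime_submodule R M N \<longleftrightarrow>
     submodule N R M \<and> N \<noteq> carrier M \<and> quasi_prime_ideal R (colon R M N)"

definition qSpec :: "('a, 'r) ring_scheme \<Rightarrow> ('a, 'b, 'm) module_scheme \<Rightarrow> 'b set set" where
  "qSpec R M = {N. quasi_prime_submodule R M N}"

definition D_set ::
  "('a, 'r) ring_scheme \<Rightarrow> ('a, 'b, 'm) module_scheme \<Rightarrow> 'b set \<Rightarrow> 'b set set" where
  "D_set R M N = {L \<in> qSpec R M. colon R M N \<subseteq> colon R M L}"

text \<open>Since \<^const>\<open>topology\<close> is meaningful only for families of sets satisfying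
  \<^const>\<open>istopology\<close>, this is verified below, and \<open>closedin_developed_zariski\<close> confirms that
  the closed sets are exactly the sets \<^const>\<open>D_set\<close>.\<close>

definition developed_zariski ::
  "('a, 'r) ring_scheme \<Rightarrow> ('a, 'b, 'm) module_scheme \<Rightarrow> 'b set topology" where
  "developed_zariski R M =
     topology (\<lambda>U. \<exists>N. submodule N R M \<and> U = qSpec R M - D_set R M N)"

text \<open>The intersection with \<^term>\<open>carrier M\<close> makes the empty intersection equal to the whole
  module; it changes nothing for a non-empty family of submodules.\<close>

definition inter_submodules :: "('a, 'b, 'm) module_scheme \<Rightarrow> 'b set set \<Rightarrow> 'b set" where
  "inter_submodules M Y = carrier M \<inter> \<Inter>Y"

definition irreducible_space :: "'x topology \<Rightarrow> bool" where
  "irreducible_space X \<longleftrightarrow>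
     topspace X \<noteq> {} \<and>
     (\<forall>U V. openin X U \<longrightarrow> openin X V \<longrightarrow> U \<noteq> {} \<longrightarrow> V \<noteq> {} \<longrightarrow> U \<inter> V \<noteq> {})"

lemma submodule_inter_submodules:
  assumes M: "Module.module R M" and F: "\<And>N. N \<in> F \<Longrightarrow> submodule N R M"
  shows "submodule (inter_submodules M F) R M"
proof -
  interpret Module.module R M by (rule M)
  have z: "\<zero>\<^bsub>M\<^esub> \<in> N" if "N \<in> F" for N
    using subgroup.one_closed[OF submodule.axioms(1)[OF F[OF that]]] by simp
  show ?thesis
    unfolding inter_submodules_def
    by (rule submoduleI) (auto dest: F intro: z submoduleE(3-5)[OF F])
qed

lemma ideal_colon:
  assumes M: "Module.module R M" and N: "submodule N R M"
  shows "ideal (colon R M N) R"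
proof -
  interpret Module.module R M by (rule M)
  note N' = submoduleE[OF N]
  have z: "\<zero>\<^bsub>M\<^esub> \<in> N"
    using subgroup.one_closed[OF submodule.axioms(1)[OF N]] by simp
  show ?thesis
  proof (rule idealI)
    show "ring R" by (rule R.ring_axioms)
    show "subgroup (colon R M N) (add_monoid R)"
    proof (rule R.add.subgroupI)
      show "colon R M N \<noteq> {}"
        using z by (auto simp: colon_def intro!: exI[of _ "\<zero>\<^bsub>R\<^esub>"])
    next
      fix a assume "a \<in> colon R M N"
      then show "\<ominus>\<^bsub>R\<^esub> a \<in> colon R M N"
        using N'(3) by (auto simp: colon_def smult_l_minus)
    qed (use N'(5) in \<open>auto simp: colon_def smult_l_distr\<close>)
  next
    fix a x assume "a \<in> colon R M N" "x \<in> carrier R"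
    then show *: "x \<otimes>\<^bsub>R\<^esub> a \<in> colon R M N"
      using N'(4) by (auto simp: colon_def smult_assoc1)
    then show "a \<otimes>\<^bsub>R\<^esub> x \<in> colon R M N"
      using \<open>a \<in> colon R M N\<close> \<open>x \<in> carrier R\<close> by (simp add: colon_def R.m_comm)
  qed
qed

lemma D_set_Un:
  assumes M: "Module.module R M" and N: "submodule N R M" "submodule N' R M"
  shows "\<exists>K. submodule K R M \<and> D_set R M K = D_set R M N \<union> D_set R M N'"
proof (intro exI conjI)
  interpret Module.module R M by (rule M)
  let ?K = "inter_submodules M {N, N'}"
  show "submodule ?K R M"
    by (rule submodule_inter_submodules[OF M]) (use N in auto)
  have K: "colon R M ?K = colon R M N \<inter> colon R M N'"
    by (auto simp: colon_def inter_submodules_def)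
  show "D_set R M ?K = D_set R M N \<union> D_set R M N'"
    unfolding D_set_def K qSpec_def quasi_prime_submodule_def quasi_prime_ideal_def
    using ideal_colon[OF M N(1)] ideal_colon[OF M N(2)] by blast
qed

lemma D_set_Int:
  assumes M: "Module.module R M" and F: "\<And>N. N \<in> F \<Longrightarrow> submodule N R M"
  shows "\<exists>K. submodule K R M \<and> D_set R M K = qSpec R M \<inter> (\<Inter>N\<in>F. D_set R M N)"
proof (intro exI conjI)
  interpret Module.module R M by (rule M)
  let ?G = "{r \<odot>\<^bsub>M\<^esub> m | r m N. N \<in> F \<and> r \<in> colon R M N \<and> m \<in> carrier M}"
  let ?K = "inter_submodules M {L. submodule L R M \<and> ?G \<subseteq> L}"
  show "submodule ?K R M"
    by (rule submodule_inter_submodules[OF M]) auto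
  have 1: "colon R M N \<subseteq> colon R M ?K" if "N \<in> F" for N
    using that unfolding colon_def inter_submodules_def by blast
  have 2: "colon R M ?K \<subseteq> colon R M L"
    if L: "submodule L R M" and *: "\<And>N. N \<in> F \<Longrightarrow> colon R M N \<subseteq> colon R M L" for L
  proof -
    have "?G \<subseteq> L"
    proof clarify
      fix r m N assume "N \<in> F" "r \<in> colon R M N" "m \<in> carrier M"
      with * show "r \<odot>\<^bsub>M\<^esub> m \<in> L" by (auto simp: colon_def)
    qed
    then have "?K \<subseteq> L" using L by (auto simp: inter_submodules_def)
    then show ?thesis by (auto simp: colon_def)
  qed
  show "D_set R M ?K = qSpec R M \<inter> (\<Inter>N\<in>F. D_set R M N)"
  proof (intro subset_antisym subsetI)
    fix L assume "L \<in> D_set R M ?K"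
    then show "L \<in> qSpec R M \<inter> (\<Inter>N\<in>F. D_set R M N)"
      using 1 unfolding D_set_def by blast
  next
    fix L assume L: "L \<in> qSpec R M \<inter> (\<Inter>N\<in>F. D_set R M N)"
    then have "colon R M ?K \<subseteq> colon R M L"
      by (intro 2) (auto simp: D_set_def qSpec_def quasi_prime_submodule_def)
    with L show "L \<in> D_set R M ?K" by (auto simp: D_set_def)
  qed
qed

lemma istopology_developed_zariski:
  assumes M: "Module.module R M"
  shows "istopology (\<lambda>U. \<exists>N. submodule N R M \<and> U = qSpec R M - D_set R M N)"
  unfolding istopology_def
proof (intro conjI allI impI)
  fix S T
  assume "\<exists>N. submodule N R M \<and> S = qSpec R M - D_set R M N"
    and "\<exists>N. submodule N R M \<and> T = qSpec R M - D_set R M N"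
  then obtain N N' where N: "submodule N R M" "submodule N' R M"
    and "S = qSpec R M - D_set R M N" "T = qSpec R M - D_set R M N'" by blast
  moreover obtain K where "submodule K R M" "D_set R M K = D_set R M N \<union> D_set R M N'"
    using D_set_Un[OF M N] by blast
  ultimately show "\<exists>N. submodule N R M \<and> S \<inter> T = qSpec R M - D_set R M N"
    by (intro exI[of _ K]) blast
next
  fix \<K> assume "\<forall>S\<in>\<K>. \<exists>N. submodule N R M \<and> S = qSpec R M - D_set R M N"
  then obtain f where f: "\<And>S. S \<in> \<K> \<Longrightarrow> submodule (f S) R M"
      "\<And>S. S \<in> \<K> \<Longrightarrow> S = qSpec R M - D_set R M (f S)" by metis
  obtain K where K: "submodule K R M"
      "D_set R M K = qSpec R M \<inter> (\<Inter>N\<in>f ` \<K>. D_set R M N)"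
    using D_set_Int[OF M, of "f ` \<K>"] f(1) by blast
  have "\<Union>\<K> = (\<Union>S\<in>\<K>. qSpec R M - D_set R M (f S))" using f(2) by blast
  also have "\<dots> = qSpec R M - D_set R M K" unfolding K(2) by blast
  finally show "\<exists>N. submodule N R M \<and> \<Union>\<K> = qSpec R M - D_set R M N" using K(1) by blast
qed

lemma openin_developed_zariski:
  assumes "Module.module R M"
  shows "openin (developed_zariski R M) U \<longleftrightarrow>
           (\<exists>N. submodule N R M \<and> U = qSpec R M - D_set R M N)"
  unfolding developed_zariski_def
  by (simp add: topology_inverse'[OF istopology_developed_zariski[OF assms]])

lemma topspace_developed_zariski:
  assumes M: "Module.module R M"
  shows "topspace (developed_zariski R M) = qSpec R M"
proof -
  have "D_set R M (carrier M) = {}"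
  proof -
    interpret Module.module R M by (rule M)
    have "colon R M (carrier M) = carrier R" by (auto simp: colon_def)
    moreover have "colon R M L \<subset> carrier R" if "L \<in> qSpec R M" for L
      using that
      by (auto simp: colon_def qSpec_def quasi_prime_submodule_def quasi_prime_ideal_def)
    ultimately show ?thesis by (auto simp: D_set_def)
  qed
  then have "openin (developed_zariski R M) (qSpec R M)"
    using Module.module.carrier_is_submodule[OF M] openin_developed_zariski[OF M] by blast
  moreover have "U \<subseteq> qSpec R M" if "openin (developed_zariski R M) U" for U
    using that openin_developed_zariski[OF M] by blast
  ultimately show ?thesis unfolding topspace_def by blast
qed

lemma closedin_developed_zariski:
  assumes M: "Module.module R M"
  shows "closedin (developed_zariski R M) C \<longleftrightarrow> (\<exists>N. submodule N R M \<and> C = D_set R M N)"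
proof -
  have "D_set R M N \<subseteq> qSpec R M" for N by (auto simp: D_set_def)
  then show ?thesis
    unfolding closedin_def topspace_developed_zariski[OF M] openin_developed_zariski[OF M]
    by (metis double_diff subset_refl)
qed

end

theory Submission
  imports Defs
begin

text \<open>Two observations drive the proof. The colon ideal of \<open>\<Im>(Y)\<close> is the intersection of the colon
  ideals of the members of \<open>Y\<close>, and for every ideal \<open>A\<close> the set of quasi-prime submodules \<open>L\<close> with
  \<open>A \<subseteq> (L:M)\<close> is closed, being \<open>D(AM)\<close>. Hence an inclusion \<open>A \<inter> B \<subseteq> (\<Im>(Y):M)\<close> says that
  \<open>Y \<subseteq> D(AM) \<union> D(BM)\<close>, and \<open>A \<subseteq> (\<Im>(Y):M)\<close> says that \<open>Y \<subseteq> D(AM)\<close>, so primality of \<open>\<Im>(Y)\<close> with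
  respect to intersections is irreducibility of \<open>Y\<close>.\<close>

text \<open>The factor \<open>carrier R\<close> covers empty \<open>F\<close>, where the
  intersection of submodules is all of \<open>M\<close>.\<close>

lemma colon_inter_submodules:
  assumes "Module.module R M"
  shows "colon R M (inter_submodules M F) = carrier R \<inter> (\<Inter>N\<in>F. colon R M N)"
proof -
  interpret Module.module R M by (rule assms)
  show ?thesis by (auto simp: colon_def inter_submodules_def)
qed

lemma D_set_of_ideal:
  assumes M: "Module.module R M" and A: "A \<subseteq> carrier R"
  obtains K where "submodule K R M" "D_set R M K = {L \<in> qSpec R M. A \<subseteq> colon R M L}"
proof
  \<comment> \<open>\<open>K\<close> is \<open>AM\<close>, as the least submodule whose colon contains \<open>A\<close>\<close>
  let ?F = "{L. submodule L R M \<and> A \<subseteq> colon R M L}"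
  let ?K = "inter_submodules M ?F"
  show "submodule ?K R M"
    by (rule submodule_inter_submodules[OF M]) simp
  have "A \<subseteq> colon R M ?K"
    using A by (auto simp: colon_inter_submodules[OF M])
  \<comment> \<open>Such an \<open>L\<close> is itself a member of \<open>?F\<close>, so its colon
    is one of those being intersected.\<close>
  moreover have "colon R M ?K \<subseteq> colon R M L"
    if "L \<in> qSpec R M" "A \<subseteq> colon R M L" for L
    using that
    by (auto simp: colon_inter_submodules[OF M] qSpec_def quasi_prime_submodule_def)
  ultimately show "D_set R M ?K = {L \<in> qSpec R M. A \<subseteq> colon R M L}"
    unfolding D_set_def by blast
qed

text \<open>Open sets of \<open>Y\<close> are the traces \<open>Y - D_set R M N\<close>; taking
  complements turns the meeting of non-empty open sets into a condition on closed covers.\<close>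

lemma irreducible_subspace_iff:
  assumes M: "Module.module R M" and Y: "Y \<subseteq> qSpec R M"
  shows "irreducible_space (subtopology (developed_zariski R M) Y) \<longleftrightarrow>
           Y \<noteq> {} \<and>
           (\<forall>N N'. submodule N R M \<longrightarrow> submodule N' R M \<longrightarrow>
              Y \<subseteq> D_set R M N \<union> D_set R M N' \<longrightarrow> Y \<subseteq> D_set R M N \<or> Y \<subseteq> D_set R M N')"
proof -
  have openin: "openin (subtopology (developed_zariski R M) Y) U \<longleftrightarrow>
      (\<exists>N. submodule N R M \<and> U = Y - D_set R M N)" for U
  proof -
    have "(qSpec R M - D_set R M N) \<inter> Y = Y - D_set R M N" for N
      using Y by blast
    then show ?thesis
      unfolding openin_subtopology openin_developed_zariski[OF M] by metis
  qed
  have "topspace (subtopology (developed_zariski R M) Y) = Y"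
    using Y by (auto simp: topspace_developed_zariski[OF M])
  then show ?thesis
    unfolding irreducible_space_def openin by blast
qed

theorem theorem3p10:
  fixes R :: "('a, 'r) ring_scheme" and M :: "('a, 'b, 'm) module_scheme"
    and Y :: "'b set set"
  assumes "cring R" and "\<one>\<^bsub>R\<^esub> \<noteq> \<zero>\<^bsub>R\<^esub>" and "Module.module R M"
    and "Y \<subseteq> qSpec R M"
  shows "quasi_prime_submodule R M (inter_submodules M Y) \<longleftrightarrow>
           irreducible_space (subtopology (developed_zariski R M) Y)"
proof -
  note M = assms(3) and Y = assms(4)
  let ?J = "inter_submodules M Y"
  have L: "submodule L R M" "L \<subseteq> carrier M" "L \<noteq> carrier M" "colon R M L \<noteq> carrier R"
    "\<And>A B. ideal A R \<Longrightarrow> ideal B R \<Longrightarrow> A \<inter> B \<subseteq> colon R M L \<Longrightarrow>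
       A \<subseteq> colon R M L \<or> B \<subseteq> colon R M L" if "L \<in> Y" for L
  proof -
    have "quasi_prime_submodule R M L" using that Y by (auto simp: qSpec_def)
    then show "submodule L R M" "L \<noteq> carrier M" "colon R M L \<noteq> carrier R"
      "\<And>A B. ideal A R \<Longrightarrow> ideal B R \<Longrightarrow> A \<inter> B \<subseteq> colon R M L \<Longrightarrow>
         A \<subseteq> colon R M L \<or> B \<subseteq> colon R M L"
      unfolding quasi_prime_submodule_def quasi_prime_ideal_def by blast+
    then show "L \<subseteq> carrier M" using Module.module.submoduleE(1)[OF M] by blast
  qed
  have J: "submodule ?J R M"
    by (rule submodule_inter_submodules[OF M]) (rule L(1))
  have le_J: "A \<subseteq> colon R M ?J \<longleftrightarrow> (\<forall>L\<in>Y. A \<subseteq> colon R M L)" if "A \<subseteq> carrier R" for A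
    using that unfolding colon_inter_submodules[OF M] by blast
  \<comment> \<open>Closed sets containing \<open>Y\<close> become ideals below the colon of
    \<open>?J\<close>, the form to which \<open>prime\<close> applies.\<close>
  have le_D: "Y \<subseteq> D_set R M N \<longleftrightarrow> colon R M N \<subseteq> colon R M ?J" for N
  proof -
    have "colon R M N \<subseteq> carrier R" by (auto simp: colon_def)
    then show ?thesis using Y by (auto simp: le_J D_set_def)
  qed
  show ?thesis
    unfolding irreducible_subspace_iff[OF M Y]
  proof (intro iffI conjI allI impI)
    assume "quasi_prime_submodule R M ?J"
    then have J_ne: "?J \<noteq> carrier M"
      and prime: "\<And>A B. ideal A R \<Longrightarrow> ideal B R \<Longrightarrow> A \<inter> B \<subseteq> colon R M ?J \<Longrightarrow>
        A \<subseteq> colon R M ?J \<or> B \<subseteq> colon R M ?J"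
      by (auto simp: quasi_prime_submodule_def quasi_prime_ideal_def)
    \<comment> \<open>The empty family would give \<open>?J = carrier M\<close>, which is not
      proper.\<close>
    show "Y \<noteq> {}" using J_ne by (auto simp: inter_submodules_def)
    fix N N' assume N: "submodule N R M" "submodule N' R M"
      and cover: "Y \<subseteq> D_set R M N \<union> D_set R M N'"
    have "colon R M N \<inter> colon R M N' \<subseteq> colon R M ?J"
      using cover by (subst le_J) (auto simp: colon_def D_set_def)
    then show "Y \<subseteq> D_set R M N \<or> Y \<subseteq> D_set R M N'"
      unfolding le_D by (rule prime[OF ideal_colon[OF M N(1)] ideal_colon[OF M N(2)]])
  next
    assume irr: "Y \<noteq> {} \<and> (\<forall>N N'. submodule N R M \<longrightarrow> submodule N' R M \<longrightarrow>
      Y \<subseteq> D_set R M N \<union> D_set R M N' \<longrightarrow> Y \<subseteq> D_set R M N \<or> Y \<subseteq> D_set R M N')"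
    then obtain L0 where L0: "L0 \<in> Y" by blast
    have "?J \<noteq> carrier M"
      using L0 L(2,3)[OF L0] by (auto simp: inter_submodules_def)
    moreover have "colon R M ?J \<noteq> carrier R"
      proof -
      have "colon R M L0 \<subseteq> carrier R" by (auto simp: colon_def)
      then show ?thesis
        using L0 L(4)[OF L0] by (auto simp: colon_inter_submodules[OF M])
    qed
    moreover have "A \<subseteq> colon R M ?J \<or> B \<subseteq> colon R M ?J"
      if AB: "ideal A R" "ideal B R" "A \<inter> B \<subseteq> colon R M ?J" for A B
    proof -
      have car: "A \<subseteq> carrier R" "B \<subseteq> carrier R"
        using AB(1,2) by (auto dest: ideal.Icarr)
      \<comment> \<open>\<open>A\<close> and \<open>B\<close> need not be colons of submodules, so
        closed sets are attached to them through \<open>K\<close> and \<open>K'\<close>.\<close>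
      obtain K where K: "submodule K R M" "D_set R M K = {L \<in> qSpec R M. A \<subseteq> colon R M L}"
        using D_set_of_ideal[OF M car(1)] .
      obtain K' where K': "submodule K' R M" "D_set R M K' = {L \<in> qSpec R M. B \<subseteq> colon R M L}"
        using D_set_of_ideal[OF M car(2)] .
      have "\<forall>L\<in>Y. A \<inter> B \<subseteq> colon R M L"
        using AB(3) le_J[of "A \<inter> B"] car by blast
      \<comment> \<open>Quasi-primeness of each \<open>L\<close> yields a choice between
        \<open>A\<close> and \<open>B\<close> that may vary with \<open>L\<close>; irreducibility
        then makes it uniform over \<open>Y\<close>.\<close>
      then have "Y \<subseteq> D_set R M K \<union> D_set R M K'"
        unfolding K(2) K'(2) using L(5)[OF _ AB(1,2)] Y by blast
      then have "Y \<subseteq> D_set R M K \<or> Y \<subseteq> D_set R M K'"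
        using irr K(1) K'(1) by blast
      then show ?thesis
        unfolding K(2) K'(2) le_J[OF car(1)] le_J[OF car(2)] by blast
    qed
    ultimately show "quasi_prime_submodule R M ?J"
      using J ideal_colon[OF M J] by (simp add: quasi_prime_submodule_def quasi_prime_ideal_def)
  qed
qed

end
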